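(* Let $n>1$ be a positive integer with $n\equiv 1\pmod{3}$. Then \begin{align*} \sum_{k=0}^{(n-1)/3} [6k+1]\frac{(q;q^3)_k^6\, (q^3;q^3)_{2k}}{(q^3;q^3)_k^6\, (q^2;q^3)_{2k}}\, q^{2k} &\equiv 0 \pmod{\Phi_n(q)},\\ \sum_{k=0}^{(n-1)/3} [6k+1]\frac{(q;q^3)_k^4\, (q^3;q^3)_{2k}}{(q^3;q^3)_k^4\, (q^2;q^3)_{2k}} &\equiv 0 \pmod{\Phi_n(q)},\\ \sum_{k=0}^{(n-1)/3} [6k+1]\frac{(q;q^3)_k^2\, (q^3;q^3)_{2k}}{(q^3;q^3)_k^2\, (q^2;q^3)_{2k}}\, q^{-2k} &\equiv 0 \pmod{\Phi_n(q)}. \end{align*}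
   Context: Here $q$ is an indeterminate. For $x$ and a base $p$ (a power of $q$), $(x;p)_k=\prod_{j=0}^{k-1}(1-xp^j)$ for integers $k\ge0$. The $q$-integer is $[j]=1+q+\cdots+q^{j-1}$ and $\Phi_n(q)$ is the $n$-th cyclotomic polynomial. For rational functions $A(q),B(q)$ and a polynomial $P(q)$, $A\equiv B\pmod{P}$ means that the numerator of the reduced form of $A-B$ is divisible by $P$ in $\mathbb{Z}[q]$. *)

theory Defs
  imports Complex_Main "HOL-Computational_Algebra.Computational_Algebra"
    "HOL-Number_Theory.Totient"
begin

definition qpoch :: "'a::comm_ring_1 \<Rightarrow> 'a \<Rightarrow> nat \<Rightarrow> 'a" where
  "qpoch x p k = (\<Prod>j<k. 1 - x * p ^ j)"

definition qint :: "'a::comm_ring_1 \<Rightarrow> nat \<Rightarrow> 'a" where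
  "qint q j = (\<Sum>i<j. q ^ i)"

definition indet_q :: "int poly fract" (\<open>\<q>\<close>) where
  "\<q> = to_fract [:0, 1:]"

text \<open>\<^const>\<open>quot_of_fract\<close> gives the reduced form over \<open>\<int>[q]\<close>: numerator and denominator
  are coprime in \<open>\<int>[q]\<close>, so integer contents are cancelled as well.\<close>

definition qcong :: "int poly fract \<Rightarrow> int poly fract \<Rightarrow> int poly \<Rightarrow> bool" where
  "qcong A B P \<longleftrightarrow> P dvd fst (quot_of_fract (A - B))"

definition cyclotomic_complex :: "nat \<Rightarrow> complex poly" where
  "cyclotomic_complex n = (\<Prod>k\<in>totatives n. [:- cis (2 * pi * real k / real n), 1:])"

text \<open>The product over the primitive roots of unity has integer coefficients
  (see \<open>of_int_cyclotomic\<close> below), so the description is well defined for \<open>n > 0\<close>.\<close>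

definition cyclotomic :: "nat \<Rightarrow> int poly" where
  "cyclotomic n = (THE P. map_poly of_int P = cyclotomic_complex n)"

lemma map_poly_of_int_mult:
  "map_poly of_int (p * q) = (map_poly of_int p * map_poly of_int q :: complex poly)"
  by (intro poly_eqI) (simp add: coeff_map_poly coeff_mult)

lemma map_poly_of_int_add:
  "map_poly of_int (p + q) = (map_poly of_int p + map_poly of_int q :: complex poly)"
  by (intro poly_eqI) (simp add: coeff_map_poly)

lemma map_poly_of_int_prod:
  "map_poly of_int (prod f A) = (\<Prod>x\<in>A. map_poly of_int (f x) :: complex poly)"
  by (induction A rule: infinite_finite_induct) (simp_all add: map_poly_of_int_mult)

lemma map_poly_of_int_inj:
  assumes "map_poly of_int p = (map_poly of_int q :: complex poly)"
  shows "p = q"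
proof (rule poly_eqI)
  fix i
  have "coeff (map_poly of_int p :: complex poly) i = coeff (map_poly of_int q) i"
    using assms by simp
  thus "coeff p i = coeff q i" by (simp add: coeff_map_poly)
qed

lemma cyclotomic_complex_monic: "lead_coeff (cyclotomic_complex n) = 1"
  unfolding cyclotomic_complex_def by (simp add: lead_coeff_prod)

lemma prod_all_roots_unity:
  assumes "n > 0"
  shows "(\<Prod>k\<in>{0<..n}. [:- cis (2 * pi * real k / real n), 1:]) = monom 1 n - 1"
    (is "?P = ?Q")
proof -
  let ?r = "\<lambda>k. cis (2 * pi * real k / real n)"
  have inj0: "inj_on ?r {..<n}"
    using bij_betw_roots_unity[OF assms] by (simp add: bij_betw_def)
  have period: "?r (k mod n) = ?r k" if "k \<in> {0<..n}" for k
    using that assms by (cases "k = n") auto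
  have "inj_on (\<lambda>k. k mod n) {0<..n}"
    by (intro inj_onI) (metis greaterThanAtMost_iff le_neq_implies_less mod_less mod_self
        less_irrefl)
  hence inj: "inj_on ?r {0<..n}"
    using inj0 period assms unfolding inj_on_def by (metis lessThan_iff mod_less_divisor)
  have degP: "degree ?P = n"
    by (subst degree_prod_sum_eq) auto
  have degQ: "degree ?Q = n"
    using assms by (subst diff_conv_add_uminus, subst degree_add_eq_left) (auto simp: degree_monom_eq)
  show ?thesis
  proof (rule poly_eqI_degree_lead_coeff[where n = n and A = "?r ` {0<..n}"])
    have "lead_coeff ?P = 1" by (simp add: lead_coeff_prod)
    thus "coeff ?P n = coeff ?Q n" using degP assms by simp
    show "card (?r ` {0<..n}) \<ge> n" using inj by (simp add: card_image)
    show "degree ?P \<le> n" "degree ?Q \<le> n" using degP degQ by simp_all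
    fix z assume "z \<in> ?r ` {0<..n}"
    then obtain k where k: "k \<in> {0<..n}" "z = ?r k" by auto
    have "poly ?P z = 0" using k by (auto simp: poly_prod)
    moreover have "z ^ n = 1"
      using k assms bij_betw_roots_unity[OF assms] period[OF k(1)]
      by (auto simp: DeMoivre intro: cis_multiple_2pi)
    ultimately show "poly ?P z = poly ?Q z" by (simp add: poly_monom)
  qed
qed

lemma prod_cyclotomic_complex:
  assumes "n > 0"
  shows "(\<Prod>d | d dvd n. cyclotomic_complex d) = monom 1 n - 1"
proof -
  have "(\<Prod>d | d dvd n. cyclotomic_complex d) =
      (\<Prod>(d,k)\<in>(SIGMA d:{d. d dvd n}. totatives d). [:- cis (2 * pi * real k / real d), 1:])"
    unfolding cyclotomic_complex_def using assms by (intro prod.Sigma) auto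
  also have "\<dots> = (\<Prod>k\<in>{0<..n}. [:- cis (2 * pi * real k / real n), 1:])"
  proof (rule prod.reindex_bij_witness[where
        i = "\<lambda>k. (n div gcd k n, k div gcd k n)" and j = "\<lambda>(d,k). k * (n div d)"])
    fix a assume "a \<in> (SIGMA d:{d. d dvd n}. totatives d)"
    then obtain d k where a: "a = (d, k)" "d dvd n" "k > 0" "k \<le> d" "coprime k d"
      by (auto simp: in_totatives_iff)
    from a(2) obtain e where e: "n = d * e" by auto
    have de: "d > 0" "e > 0" using e assms by auto
    have g: "gcd (k * e) (d * e) = e"
      using a(5) by (simp add: gcd_mult_right[symmetric] gcd_mult_distrib_nat mult.commute[of _ e]
          flip: gcd_mult_distrib_nat)
    show "(\<lambda>k. (n div gcd k n, k div gcd k n)) ((\<lambda>(d,k). k * (n div d)) a) = a"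
      using a e de g by simp
    show "(\<lambda>(d,k). k * (n div d)) a \<in> {0<..n}"
      using a e de by simp
    show "[:- cis (2 * pi * real ((\<lambda>(d,k). k * (n div d)) a) / real n), 1:] =
      (case a of (d, k) \<Rightarrow> [:- cis (2 * pi * real k / real d), 1:])"
      using a e de by (simp add: field_simps)
  next
    fix k assume k: "k \<in> {0<..n}"
    define g where "g = gcd k n"
    have g: "g > 0" "g dvd k" "g dvd n" using k by (auto simp: g_def)
    have "coprime (k div g) (n div g)"
      unfolding g_def using k by (intro div_gcd_coprime) auto
    moreover have "k div g > 0" "k div g \<le> n div g"
      using g k by (auto simp: div_greater_zero_iff dvd_imp_le div_le_mono)
    ultimately show "(n div gcd k n, k div gcd k n) \<in> (SIGMA d:{d. d dvd n}. totatives d)"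
      using g by (auto simp: g_def[symmetric] in_totatives_iff)
    show "(\<lambda>(d,k). k * (n div d)) (n div gcd k n, k div gcd k n) = k"
      using g assms by (auto simp: g_def[symmetric] elim!: dvdE)
  qed
  also have "\<dots> = monom 1 n - 1" by (rule prod_all_roots_unity[OF assms])
  finally show ?thesis .
qed

lemma cyclotomic_complex_integral:
  assumes "n > 0"
  shows "\<exists>P :: int poly. map_poly of_int P = cyclotomic_complex n"
  using assms
proof (induction n rule: less_induct)
  case (less n)
  let ?M = "map_poly of_int :: int poly \<Rightarrow> complex poly"
  define D where "D = {d. d dvd n \<and> d \<noteq> n}"
  have "\<exists>P. ?M P = cyclotomic_complex d" if "d \<in> D" for d
    using that less.prems by (intro less.IH) (auto simp: D_def intro: dvd_pos_nat dest: dvd_imp_le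
        simp: le_neq_implies_less)
  then obtain F where F: "\<And>d. d \<in> D \<Longrightarrow> ?M (F d) = cyclotomic_complex d"
    by metis
  define g where "g = (\<Prod>d\<in>D. F d)"
  define f where "f = (monom 1 n - 1 :: int poly)"
  have Mg: "?M g = (\<Prod>d\<in>D. cyclotomic_complex d)"
    unfolding g_def map_poly_of_int_prod by (intro prod.cong refl F)
  have degM: "degree (?M p) = degree p" for p
    by (intro degree_map_poly) auto
  have lc: "lead_coeff g = 1"
  proof -
    have "lead_coeff (?M g) = 1"
      unfolding Mg by (simp add: lead_coeff_prod cyclotomic_complex_monic)
    hence "(of_int (lead_coeff g) :: complex) = 1" unfolding degM by (simp add: coeff_map_poly)
    thus ?thesis by simp
  qed
  hence g0: "g \<noteq> 0" by auto
  have "{d. d dvd n} = insert n D" by (auto simp: D_def)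
  moreover have "finite D" using less.prems by (auto simp: D_def)
  ultimately have "(\<Prod>d | d dvd n. cyclotomic_complex d) = cyclotomic_complex n * ?M g"
    by (simp add: Mg D_def)
  moreover have Mf: "?M f = monom 1 n - 1"
    by (intro poly_eqI) (simp add: f_def coeff_map_poly)
  ultimately have eq: "?M f = cyclotomic_complex n * ?M g"
    using prod_cyclotomic_complex[OF less.prems] by simp
  obtain s r where sr: "pseudo_divmod f g = (s, r)" by fastforce
  have fs: "f = g * s + r" and r: "r = 0 \<or> degree r < degree g"
    using pseudo_divmod[OF g0 sr] lc by auto
  have "?M r = ?M g * (cyclotomic_complex n - ?M s)"
    using eq fs by (simp add: map_poly_of_int_mult map_poly_of_int_add algebra_simps)
  moreover have Mg0: "?M g \<noteq> 0" using g0 map_poly_of_int_inj[of g 0] by auto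
  ultimately have "cyclotomic_complex n - ?M s = 0"
  proof (cases "cyclotomic_complex n - ?M s = 0")
    case False
    assume *: "?M r = ?M g * (cyclotomic_complex n - ?M s)"
    hence "degree (?M r) \<ge> degree (?M g)" using False Mg0 by (simp add: degree_mult_eq)
    moreover have "?M r \<noteq> 0" using * False Mg0 by simp
    ultimately show ?thesis using r degM by auto
  qed
  thus ?case by (intro exI[of _ s]) simp
qed

lemma of_int_cyclotomic:
  assumes "n > 0"
  shows "map_poly of_int (cyclotomic n) = cyclotomic_complex n"
  unfolding cyclotomic_def
  by (rule theI') (use cyclotomic_complex_integral[OF assms] map_poly_of_int_inj in metis)

end

theory Submission
  imports Defs
begin

text \<open>Let \<open>\<zeta>\<close> be a primitive \<open>n\<close>-th root of unity, \<open>n = 3 m + 1\<close> and \<open>p = \<zeta>\<^sup>3\<close>, so that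
  \<open>\<zeta> = p\<^sup>-\<^sup>m\<close>. At \<open>q = \<zeta>\<close> no denominator vanishes, and the substitution \<open>k \<mapsto> m - k\<close> turns each
  summand into its negative: with \<open>u = p\<^bsup>2k-m\<^esup>\<close>, it multiplies \<open>((q;p)\<^sub>k/(p;p)\<^sub>k)\<^sup>2\<close> by \<open>u\<^bsup>m+1\<^esup>\<close>,
  \<open>(p;p)\<^bsub>2k\<^esub>/(q\<^sup>2;p)\<^bsub>2k\<^esub>\<close> by \<open>u\<^bsup>-(2m+1)\<^esup>\<close>, \<open>q\<^bsup>2k\<^esup>\<close> by \<open>u\<^bsup>2m\<^esup>\<close> and \<open>[6k+1]\<close> by \<open>-u\<^sup>-\<^sup>1\<close>. With
  the power \<open>2 s\<close> of the first quotient and the weight \<open>q\<^bsup>2(s-2)k\<^esup>\<close> the total factor is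
  \<open>-u\<^bsup>(s-2)n\<^esup> = -1\<close>. The three sums are the cases \<open>s = 3, 2, 1\<close>.\<close>

section \<open>The sums at a root of unity\<close>

text \<open>Since \<open>x = p^-M\<close>, the last k factors of (x;p)_M are 1 - p^-i = -p^-i (1 -
  p^i) for i = 1..k. Moving them to the other side leaves the sign and the power of p with exponent
  1 + ... + k.\<close>

lemma qpoch_reflect:
  fixes x p :: "'a::comm_ring_1"
  assumes "x * p ^ M = 1" and "k \<le> M"
  shows "qpoch x p (M - k) * qpoch p p k = qpoch x p M * ((-1) ^ k * p ^ (\<Sum>{..k}))"
  using \<open>k \<le> M\<close>
proof (induction k)
  case 0
  show ?case by (simp add: qpoch_def)
next
  case (Suc k)
  define y where "y = x * p ^ (M - Suc k)"
  have M: "M = (M - Suc k) + Suc k" and Mk: "M - k = Suc (M - Suc k)"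
    using Suc.prems by simp_all
  have y: "y * p ^ Suc k = 1"
    using assms(1) M by (simp only: y_def mult.assoc flip: power_add)
  have "qpoch x p (M - k) = qpoch x p (M - Suc k) * (1 - y)"
    unfolding Mk by (simp add: qpoch_def y_def)
  moreover have "qpoch p p (Suc k) = qpoch p p k * (1 - p ^ Suc k)"
    by (simp add: qpoch_def)
  moreover have "1 - p ^ Suc k = - (p ^ Suc k) * (1 - y)"
    using y by (simp add: algebra_simps)
  ultimately have "qpoch x p (M - Suc k) * qpoch p p (Suc k) =
      - (p ^ Suc k) * (qpoch x p (M - k) * qpoch p p k)"
    by (simp only: mult_ac)
  also have "qpoch x p (M - k) * qpoch p p k = qpoch x p M * ((-1) ^ k * p ^ (\<Sum>{..k}))"
    using Suc by simp
  finally show ?case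
    by (simp add: power_add mult_ac)
qed

text \<open>Reflection at \<open>k\<close> and at \<open>M - k\<close> share the factor
  \<open>qpoch x p M\<close>, so both sides equal it times the two sign-and-power factors. The form
  without division works in any commutative ring.\<close>

lemma qpoch_cross_reflect:
  fixes x p :: "'a::comm_ring_1"
  assumes "x * p ^ M = 1" and "k \<le> M"
  shows "qpoch p p (M - k) * qpoch x p k * ((-1) ^ k * p ^ (\<Sum>{..k})) =
         qpoch p p k * qpoch x p (M - k) * ((-1) ^ (M - k) * p ^ (\<Sum>{..M - k}))"
  using qpoch_reflect[OF assms] qpoch_reflect[OF assms(1), of "M - k"] assms(2)
  by (simp add: mult_ac)

lemma two_gauss_sum: "2 * \<Sum>{..k::nat} = k * (k + 1)"
  by (induction k) simp_all

text \<open>Squaring removes the signs and turns the triangular exponents into j(j+1). What remains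
  is the exponent k(k+1) - (M-k)(M-k+1) = (2k-M)(M+1).\<close>

lemma qpoch_ratio_reflect:
  fixes x p :: "'a::field"
  assumes x: "x * p ^ M = 1" and k: "k \<le> M" and p: "p \<noteq> 0"
    and nz: "qpoch p p k \<noteq> 0" "qpoch p p (M - k) \<noteq> 0"
  shows "(qpoch x p (M - k) / qpoch p p (M - k)) ^ 2 =
         (qpoch x p k / qpoch p p k) ^ 2 * (p powi (2 * int k - int M)) powi (int M + 1)"
proof -
  define A where "A k = qpoch x p k / qpoch p p k" for k
  have sq: "((-1) ^ j * p ^ (\<Sum>{..j})) ^ 2 = p powi (int j * (int j + 1))" for j
  proof -
    have "((-1) ^ j * p ^ (\<Sum>{..j})) ^ 2 = p ^ (2 * \<Sum>{..j})"
      by (simp add: power_mult_distrib mult.commute flip: power_mult)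
    also have "\<dots> = p powi (int (j * (j + 1)))"
      unfolding two_gauss_sum by (rule power_int_of_nat[symmetric])
    finally show ?thesis by (simp add: algebra_simps)
  qed
  have "A (M - k) * ((-1) ^ (M - k) * p ^ (\<Sum>{..M - k})) = A k * ((-1) ^ k * p ^ (\<Sum>{..k}))"
    using qpoch_cross_reflect[OF x k] nz by (simp add: A_def field_simps)
  hence "(A (M - k) * ((-1) ^ (M - k) * p ^ (\<Sum>{..M - k}))) ^ 2 =
      (A k * ((-1) ^ k * p ^ (\<Sum>{..k}))) ^ 2"
    by simp
  hence "A (M - k) ^ 2 * p powi (int (M - k) * (int (M - k) + 1)) =
      A k ^ 2 * p powi (int k * (int k + 1))"
    by (simp only: power_mult_distrib[of "A _"] sq)
  also have "int k * (int k + 1) =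
      (2 * int k - int M) * (int M + 1) + int (M - k) * (int (M - k) + 1)"
    using k by (simp add: of_nat_diff algebra_simps)
  finally show ?thesis
    using p by (simp add: power_int_add power_int_mult A_def)
qed

text \<open>The cross relation with \<open>M = 2 * m\<close> and even indices, where the signs
  disappear without squaring. The exponents are now j(2j+1), and (m-k)(2(m-k)+1) - k(2k+1) =
  -(2k-m)(2m+1).\<close>

lemma qpoch_inverse_ratio_reflect:
  fixes x p :: "'a::field"
  assumes x: "x * p ^ (2 * m) = 1" and k: "k \<le> m" and p: "p \<noteq> 0"
    and nz: "qpoch x p (2 * k) \<noteq> 0" "qpoch x p (2 * (m - k)) \<noteq> 0"
  shows "qpoch p p (2 * (m - k)) / qpoch x p (2 * (m - k)) =
         qpoch p p (2 * k) / qpoch x p (2 * k) *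
           (p powi (2 * int k - int m)) powi (- (2 * int m + 1))"
proof -
  define B where "B j = qpoch p p j / qpoch x p j" for j
  have gs: "p ^ (\<Sum>{..2 * j}) = p powi (int j * (2 * int j + 1))" for j :: nat
  proof -
    have "\<Sum>{..2 * j} = j * (2 * j + 1)"
      using two_gauss_sum[of "2 * j"] by simp
    hence "p ^ (\<Sum>{..2 * j}) = p powi int (j * (2 * j + 1))"
      by (simp only: power_int_of_nat)
    thus ?thesis by (simp add: algebra_simps)
  qed
  have "B (2 * (m - k)) * p ^ (\<Sum>{..2 * k}) = B (2 * k) * p ^ (\<Sum>{..2 * (m - k)})"
    using qpoch_cross_reflect[OF x, of "2 * k", folded diff_mult_distrib2] k nz
    by (simp add: B_def frac_eq_eq mult_ac)
  hence "B (2 * (m - k)) * p powi (int k * (2 * int k + 1)) =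
      B (2 * k) * p powi (int (m - k) * (2 * int (m - k) + 1))"
    by (simp only: gs)
  also have "int (m - k) * (2 * int (m - k) + 1) =
      (2 * int k - int m) * (- (2 * int m + 1)) + int k * (2 * int k + 1)"
    using k by (simp add: of_nat_diff algebra_simps)
  finally have "B (2 * (m - k)) * p powi (int k * (2 * int k + 1)) =
      B (2 * k) * (p powi (2 * int k - int m)) powi (- (2 * int m + 1)) *
        p powi (int k * (2 * int k + 1))"
    by (simp only: power_int_add[OF disjI1[OF p]] power_int_mult mult.assoc)
  thus ?thesis
    using p by (simp only: mult_cancel_right power_int_eq_0_iff B_def simp_thms)
qed

lemma qint_geometric: "(1 - q) * qint q j = 1 - q ^ j"
  unfolding qint_def by (rule one_diff_power_eq[symmetric])

lemma qpoch_nonzero_iff: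
  fixes x p :: "'a::idom"
  shows "qpoch x p k \<noteq> 0 \<longleftrightarrow> (\<forall>j<k. x * p ^ j \<noteq> 1)"
  by (auto simp: qpoch_def)

section \<open>Nonvanishing and antisymmetry at an element of order 3m+1\<close>

context
  fixes q :: "'a::field" and m :: nat
  assumes m: "m > 0" and prim: "\<And>j. q ^ j = 1 \<longleftrightarrow> 3 * m + 1 dvd j"
begin

lemma root_nonzero: "q \<noteq> 0"
  using prim[of "3 * m + 1"] by (auto simp: power_0_left)

text \<open>A vanishing factor would make 3m+1 divide 3(j+1); but 3 is coprime to 3m+1, and j+1 is
  at most 2m.\<close>

lemma qpoch_cube_nonzero:
  assumes "k \<le> 2 * m"
  shows "qpoch (q^3) (q^3) k \<noteq> 0"
  unfolding qpoch_nonzero_iff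
proof (intro allI impI)
  fix j assume "j < k"
  have "coprime (3 * m + 1) 3"
    by (metis coprime_Suc_left_nat coprime_commute coprime_mult_left_iff Suc_eq_plus1)
  moreover have "\<not> 3 * m + 1 dvd Suc j"
    using \<open>j < k\<close> assms by (intro nat_dvd_not_less) simp_all
  ultimately have "\<not> 3 * m + 1 dvd 3 * Suc j"
    by (simp only: coprime_dvd_mult_right_iff simp_thms)
  thus "q^3 * (q^3) ^ j \<noteq> 1"
    using prim[of "3 * Suc j"] by (simp only: power_mult simp_thms flip: power_Suc)
qed

text \<open>A vanishing factor would make 2+3j a multiple of 3m+1. It lies strictly between 0 and
  2(3m+1), so it would be 3m+1 itself, which is impossible modulo 3.\<close>

lemma qpoch_square_nonzero:
  assumes "k \<le> 2 * m"
  shows "qpoch (q^2) (q^3) k \<noteq> 0"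
  unfolding qpoch_nonzero_iff
proof (intro allI impI)
  fix j assume "j < k"
  have "\<not> 3 * m + 1 dvd 2 + 3 * j"
  proof
    assume "3 * m + 1 dvd 2 + 3 * j"
    then obtain c where c: "2 + 3 * j = (3 * m + 1) * c" ..
    moreover have "2 + 3 * j < (3 * m + 1) * 2"
      using \<open>j < k\<close> assms by simp
    ultimately have "c < 2" by (simp only: mult_less_cancel1)
    hence "c = 0 \<or> c = 1" by auto
    thus False using c by (elim disjE) (simp, simp, presburger)
  qed
  thus "q^2 * (q^3) ^ j \<noteq> 1"
    using prim[of "2 + 3 * j"] by (simp only: power_add power_mult simp_thms)
qed

text \<open>The weight exponent \<open>2 * (int s - 2)\<close> is tuned so that the powers of
  \<open>u\<close> produced by the reflection add up to a multiple of 3m+1 for every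
  \<open>s\<close>. It is negative for small \<open>s\<close>, hence the integer power.\<close>

lemma summand_antisymmetric:
  fixes s :: nat
  defines "t \<equiv> \<lambda>k. qint q (6 * k + 1) * (qpoch q (q^3) k ^ (2 * s) * qpoch (q^3) (q^3) (2 * k))
      / (qpoch (q^3) (q^3) k ^ (2 * s) * qpoch (q^2) (q^3) (2 * k)) * q powi (2 * (int s - 2) * int k)"
  assumes k: "k \<le> m"
  shows "t (m - k) = - t k"
proof -
  define p where "p = q ^ 3"
  define u where "u = p powi (2 * int k - int m)"
  define A where "A k = (qpoch q p k / qpoch p p k) ^ 2" for k
  define B where "B k = qpoch p p (2 * k) / qpoch (q^2) p (2 * k)" for k
  define w where "w k = q powi (2 * (int s - 2) * int k)" for k
  have t: "t k = qint q (6 * k + 1) * A k ^ s * B k * w k" for k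
    by (simp add: t_def A_def B_def w_def p_def power_divide power_mult)
  have q0: "q \<noteq> 0" and p0: "p \<noteq> 0" using root_nonzero by (simp_all add: p_def)
  have u0: "u \<noteq> 0" using p0 by (simp add: u_def)
  have q1: "q \<noteq> 1" using prim[of 1] m by simp
  have qn: "q ^ (3 * m + 1) = 1" using prim[of "3 * m + 1"] by simp
  have x1: "q * p ^ m = 1"
    using qn by (simp add: p_def mult.commute flip: power_mult)
  have "q^2 * p ^ (2 * m) = (q * p ^ m) ^ 2"
    by (simp add: power_mult_distrib mult.commute flip: power_mult)
  hence x2: "q^2 * p ^ (2 * m) = 1" using x1 by simp
  \<comment> \<open>\<open>u\<close> is itself an integer power of \<open>q\<close>, so its order
    divides 3m+1.\<close>
  have un: "u powi (int (3 * m + 1)) = 1"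
  proof -
    have "u powi (int (3 * m + 1)) = (q powi int (3 * m + 1)) powi (3 * (2 * int k - int m))"
      by (simp add: u_def p_def power_int_power mult_ac flip: power_int_mult)
    thus ?thesis using qn by (simp only: power_int_of_nat power_int_1_left)
  qed
  have qp: "q = p powi (- int m)"
    using x1 p0 by (simp add: power_int_minus field_simps)
  have A: "A (m - k) = A k * u powi (int m + 1)"
    unfolding A_def u_def
    by (rule qpoch_ratio_reflect[OF x1 k p0]) (unfold p_def, use k in \<open>auto intro!: qpoch_cube_nonzero\<close>)
  have B: "B (m - k) = B k * u powi (- (2 * int m + 1))"
    unfolding B_def u_def
    by (rule qpoch_inverse_ratio_reflect[OF x2 k p0])
      (unfold p_def, use k in \<open>auto intro!: qpoch_square_nonzero\<close>)
  have w: "w (m - k) = w k * u powi (2 * (int s - 2) * int m)"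
  proof -
    have "2 * (int s - 2) * int (m - k) =
        2 * (int s - 2) * int k + (- (2 * int k - int m)) * (2 * (int s - 2))"
      using k by (simp add: of_nat_diff algebra_simps)
    hence "w (m - k) = w k * q powi ((- (2 * int k - int m)) * (2 * (int s - 2)))"
      unfolding w_def by (simp only: power_int_add[OF disjI1[OF q0]])
    also have "q powi ((- (2 * int k - int m)) * (2 * (int s - 2))) =
        u powi (2 * (int s - 2) * int m)"
      by (subst qp, unfold u_def, subst (1 2) power_int_mult[symmetric])
        (simp add: algebra_simps)
    finally show ?thesis .
  qed
  \<comment> \<open>Used through \<open>qint_geometric\<close>: (1-q)[6j+1] = 1 - p^(2j-m), which is
    1 - u for j = k and 1 - 1/u = -(1-u)/u for j = m-k.\<close>
  have v: "q ^ (6 * j + 1) = p powi (2 * int j - int m)" for j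
  proof -
    have "q ^ (6 * j + 1) = p powi (int (2 * j)) * q"
      by (simp only: power_int_of_nat) (simp add: p_def flip: power_mult)
    also have "\<dots> = p powi (int (2 * j) + (- int m))"
      unfolding power_int_add[OF disjI1[OF p0]] by (simp only: qp[symmetric])
    finally show ?thesis by simp
  qed
  have "(1 - q) * qint q (6 * (m - k) + 1) = 1 - p powi (2 * int (m - k) - int m)"
    unfolding qint_geometric v ..
  also have "2 * int (m - k) - int m = - (2 * int k - int m)"
    using k by (simp add: of_nat_diff)
  also have "1 - p powi (- (2 * int k - int m)) = - (u powi (-1)) * (1 - u)"
    using u0 by (simp only: u_def[symmetric] power_int_minus) (simp add: field_simps)
  also have "1 - u = (1 - q) * qint q (6 * k + 1)"
    unfolding qint_geometric v u_def ..
  finally have "(1 - q) * qint q (6 * (m - k) + 1) =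
      (1 - q) * (- (qint q (6 * k + 1) * u powi (-1)))"
    by (simp only: mult_ac mult_minus_left mult_minus_right)
  hence I: "qint q (6 * (m - k) + 1) = - (qint q (6 * k + 1) * u powi (-1))"
    using q1 by (simp only: mult_cancel_left) simp
  have "t (m - k) = - (t k * (u powi (-1) * (u powi (int m + 1)) ^ s *
      u powi (- (2 * int m + 1)) * u powi (2 * (int s - 2) * int m)))"
    unfolding t A B w I by (simp add: power_mult_distrib mult_ac)
  also have "u powi (-1) * (u powi (int m + 1)) ^ s * u powi (- (2 * int m + 1)) *
      u powi (2 * (int s - 2) * int m) =
      u powi (-1 + (int m + 1) * int s + (- (2 * int m + 1)) + 2 * (int s - 2) * int m)"
    unfolding power_int_power' unfolding power_int_add[OF disjI1[OF u0]] ..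
  also have "-1 + (int m + 1) * int s + (- (2 * int m + 1)) + 2 * (int s - 2) * int m =
      int (3 * m + 1) * (int s - 2)"
    by (simp add: algebra_simps)
  also have "u powi \<dots> = 1"
    by (simp only: power_int_mult un power_int_1_left)
  finally show ?thesis by simp
qed

end

lemma sum_root_of_unity_eq_0:
  fixes q :: "'a::field_char_0"
  assumes "m > 0" and "\<And>j. q ^ j = 1 \<longleftrightarrow> 3 * m + 1 dvd j"
  shows "(\<Sum>k=0..m. qint q (6 * k + 1) * (qpoch q (q^3) k ^ (2 * s) * qpoch (q^3) (q^3) (2 * k))
      / (qpoch (q^3) (q^3) k ^ (2 * s) * qpoch (q^2) (q^3) (2 * k))
      * q powi (2 * (int s - 2) * int k)) = 0" (is "(\<Sum>k=0..m. ?t k) = 0")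
proof -
  have "(\<Sum>k=0..m. ?t k) = (\<Sum>k=0..m. ?t (m - k))"
    using sum.nat_diff_reindex[of ?t "Suc m"] by (simp add: atLeast0AtMost lessThan_Suc_atMost)
  also have "\<dots> = (\<Sum>k=0..m. - ?t k)"
    by (intro sum.cong refl summand_antisymmetric assms) simp
  \<comment> \<open>The sum equals its own negative, hence is 0 in characteristic 0.\<close>
  finally show ?thesis by (simp add: sum_negf)
qed

section \<open>Evaluation of rational functions and divisibility by cyclotomic polynomials\<close>

abbreviation cpoly :: "int poly \<Rightarrow> complex \<Rightarrow> complex" where
  "cpoly a \<equiv> poly (map_poly of_int a)"

text \<open>A relation witnessed by any fraction, reduced or not, whose denominator does not vanish
  at \<open>z\<close>. Values can thus be computed along the structure of an expression without
  cancelling.\<close>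

definition evaluates_to :: "complex \<Rightarrow> int poly fract \<Rightarrow> complex \<Rightarrow> bool" where
  "evaluates_to z x v \<longleftrightarrow>
     (\<exists>a b. x = to_fract a / to_fract b \<and> cpoly b z \<noteq> 0 \<and> v = cpoly a z / cpoly b z)"

lemma evaluates_toI:
  assumes "x = to_fract a / to_fract b" "cpoly b z \<noteq> 0" "v = cpoly a z / cpoly b z"
  shows "evaluates_to z x v"
  using assms unfolding evaluates_to_def by blast

lemma evaluates_toE:
  assumes "evaluates_to z x v"
  obtains a b where "x = to_fract a / to_fract b" "b \<noteq> 0" "cpoly b z \<noteq> 0"
    "v = cpoly a z / cpoly b z"
  using assms unfolding evaluates_to_def by fastforce

lemma evaluates_to_indet: "evaluates_to z \<q> z"
  by (rule evaluates_toI[of _ "[:0, 1:]" 1]) (simp_all add: indet_q_def map_poly_pCons)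

lemma evaluates_to_0: "evaluates_to z 0 0"
  by (rule evaluates_toI[of _ 0 1]) simp_all

lemma evaluates_to_1: "evaluates_to z 1 1"
  by (rule evaluates_toI[of _ 1 1]) simp_all

lemma evaluates_to_add:
  assumes "evaluates_to z x v" "evaluates_to z y w"
  shows "evaluates_to z (x + y) (v + w)"
proof -
  obtain a b c d where "x = to_fract a / to_fract b" "b \<noteq> 0" "cpoly b z \<noteq> 0"
      "v = cpoly a z / cpoly b z" "y = to_fract c / to_fract d" "d \<noteq> 0" "cpoly d z \<noteq> 0"
      "w = cpoly c z / cpoly d z"
    using assms by (elim evaluates_toE)
  thus ?thesis
    by (intro evaluates_toI[of _ "a * d + c * b" "b * d"])
      (simp_all add: map_poly_of_int_mult map_poly_of_int_add add_frac_eq)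
qed

lemma evaluates_to_mult:
  assumes "evaluates_to z x v" "evaluates_to z y w"
  shows "evaluates_to z (x * y) (v * w)"
proof -
  obtain a b c d where "x = to_fract a / to_fract b" "b \<noteq> 0" "cpoly b z \<noteq> 0"
      "v = cpoly a z / cpoly b z" "y = to_fract c / to_fract d" "d \<noteq> 0" "cpoly d z \<noteq> 0"
      "w = cpoly c z / cpoly d z"
    using assms by (elim evaluates_toE)
  thus ?thesis
    by (intro evaluates_toI[of _ "a * c" "b * d"]) (simp_all add: map_poly_of_int_mult)
qed

lemma evaluates_to_uminus:
  assumes "evaluates_to z x v"
  shows "evaluates_to z (- x) (- v)"
proof -
  have "to_fract [:- 1:] = (- 1 :: int poly fract)"
    by (simp add: one_pCons flip: to_fract_uminus to_fract_1)
  hence "evaluates_to z (- 1) (- 1)"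
    by (intro evaluates_toI[of _ "[:- 1:]" 1]) (simp_all add: map_poly_pCons)
  from evaluates_to_mult[OF this assms] show ?thesis by simp
qed

lemma evaluates_to_diff:
  assumes "evaluates_to z x v" "evaluates_to z y w"
  shows "evaluates_to z (x - y) (v - w)"
  using evaluates_to_add[OF assms(1) evaluates_to_uminus[OF assms(2)]] by simp

lemma evaluates_to_inverse:
  assumes "evaluates_to z x v" "v \<noteq> 0"
  shows "evaluates_to z (inverse x) (inverse v)"
proof -
  obtain a b where "x = to_fract a / to_fract b" "cpoly b z \<noteq> 0" "v = cpoly a z / cpoly b z"
    using assms by (elim evaluates_toE)
  thus ?thesis using assms(2)
    by (intro evaluates_toI[of _ b a]) simp_all
qed

lemma evaluates_to_divide:
  assumes "evaluates_to z x v" "evaluates_to z y w" "w \<noteq> 0"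
  shows "evaluates_to z (x / y) (v / w)"
  using evaluates_to_mult[OF assms(1) evaluates_to_inverse[OF assms(2,3)]]
  by (simp add: divide_inverse)

lemma evaluates_to_power:
  assumes "evaluates_to z x v"
  shows "evaluates_to z (x ^ k) (v ^ k)"
  by (induction k) (simp_all add: evaluates_to_1 evaluates_to_mult assms)

lemma evaluates_to_power_int:
  assumes "evaluates_to z x v" "v \<noteq> 0"
  shows "evaluates_to z (x powi k) (v powi k)"
  using assms by (simp add: power_int_def evaluates_to_power evaluates_to_inverse)

lemma evaluates_to_sum:
  assumes "\<And>k. k \<in> A \<Longrightarrow> evaluates_to z (f k) (g k)"
  shows "evaluates_to z (sum f A) (sum g A)"
  using assms
  by (induction A rule: infinite_finite_induct) (simp_all add: evaluates_to_0 evaluates_to_add)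

lemma evaluates_to_prod:
  assumes "\<And>k. k \<in> A \<Longrightarrow> evaluates_to z (f k) (g k)"
  shows "evaluates_to z (prod f A) (prod g A)"
  using assms
  by (induction A rule: infinite_finite_induct) (simp_all add: evaluates_to_1 evaluates_to_mult)

lemma evaluates_to_qint:
  assumes "evaluates_to z x v"
  shows "evaluates_to z (qint x j) (qint v j)"
  unfolding qint_def by (intro evaluates_to_sum evaluates_to_power assms)

lemma evaluates_to_qpoch:
  assumes "evaluates_to z x v" "evaluates_to z y w"
  shows "evaluates_to z (qpoch x y k) (qpoch v w k)"
  unfolding qpoch_def
  by (intro evaluates_to_prod evaluates_to_diff evaluates_to_mult evaluates_to_power
      evaluates_to_1 assms)

text \<open>Cross-multiplying the reduced fraction with the witness gives
  \<open>N * b = a * D\<close>, where at \<open>z\<close> the factor \<open>a\<close> vanishes and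
  \<open>b\<close> does not.\<close>

lemma numerator_root:
  assumes "evaluates_to z x 0"
  shows "cpoly (fst (quot_of_fract x)) z = 0"
proof -
  obtain a b where ab: "x = to_fract a / to_fract b" "b \<noteq> 0" "cpoly b z \<noteq> 0"
      "0 = cpoly a z / cpoly b z"
    using assms by (elim evaluates_toE)
  define N D where "N = fst (quot_of_fract x)" and "D = snd (quot_of_fract x)"
  have "x = to_fract N / to_fract D" "D \<noteq> 0"
    by (simp_all add: N_def D_def flip: Fract_conv_to_fract)
  hence "to_fract (N * b) = to_fract (a * D)"
    using ab(1,2) by (simp add: field_simps)
  hence "N * b = a * D" by (simp only: to_fract_eq_iff)
  hence "cpoly N z * cpoly b z = cpoly a z * cpoly D z"
    by (metis map_poly_of_int_mult poly_mult)
  thus ?thesis using ab(3,4) by (simp add: N_def)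
qed

section \<open>Primitive roots of unity and divisibility by \<open>cyclotomic n\<close>\<close>

lemma cis_root_power_eq_1_iff:
  assumes "n > 0" "coprime k n"
  shows "cis (2 * pi * real k / real n) ^ j = 1 \<longleftrightarrow> n dvd j"
proof
  assume "cis (2 * pi * real k / real n) ^ j = 1"
  hence "cis (2 * pi * real (j * k) / real n) = 1"
    by (simp add: DeMoivre mult_ac)
  hence "sin (2 * pi * real (j * k) / real n) = sin 0 \<and> cos (2 * pi * real (j * k) / real n) = cos 0"
    by (simp add: complex_eq_iff)
  then obtain i :: int where "2 * pi * real (j * k) / real n = 0 + 2 * pi * i"
    unfolding sin_cos_eq_iff by blast
  hence "2 * pi * real (j * k) = 2 * pi * (i * real n)"
    using assms by (simp add: field_simps)
  hence "real (j * k) = i * real n"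
    by simp
  hence "of_int (int (j * k)) = (of_int (i * int n) :: real)"
    by simp
  hence "int (j * k) = i * int n"
    by (simp only: of_int_eq_iff)
  hence "int n dvd int (j * k)" by simp
  hence "n dvd j * k" by (simp only: int_dvd_int_iff)
  thus "n dvd j" using assms by (simp add: coprime_dvd_mult_left_iff coprime_commute)
next
  assume "n dvd j"
  then obtain c where "j = n * c" ..
  thus "cis (2 * pi * real k / real n) ^ j = 1"
    using assms cis_multiple_2pi[of "real (k * c)"] by (simp add: DeMoivre mult_ac)
qed

text \<open>As \<open>cyclotomic n\<close> is monic, pseudo-division is genuine division over the
  integers. The remainder has degree below the number of totatives of n but vanishes at that many
  distinct roots, so it is 0.\<close>

lemma cyclotomic_dvd:
  assumes "n > 0"
    and root: "\<And>k. k \<in> totatives n \<Longrightarrow> cpoly N (cis (2 * pi * real k / real n)) = 0"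
  shows "cyclotomic n dvd N"
proof -
  define g where "g = cyclotomic n"
  let ?r = "\<lambda>k. cis (2 * pi * real k / real n)"
  let ?M = "map_poly of_int :: int poly \<Rightarrow> complex poly"
  have degM: "degree (?M p) = degree p" for p
    by (intro degree_map_poly) auto
  have Mg: "?M g = cyclotomic_complex n"
    unfolding g_def by (rule of_int_cyclotomic[OF assms(1)])
  have deg: "degree g = card (totatives n)"
    unfolding degM[of g, symmetric] Mg cyclotomic_complex_def
    by (subst degree_prod_sum_eq) auto
  have "of_int (lead_coeff g) = (1 :: complex)"
    using cyclotomic_complex_monic[of n] unfolding Mg[symmetric] degM by (simp add: coeff_map_poly)
  hence lc: "lead_coeff g = 1" by simp
  hence "g \<noteq> 0" by auto
  obtain s r where sr: "pseudo_divmod N g = (s, r)" by fastforce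
  have N: "N = g * s + r" and r: "r = 0 \<or> degree r < degree g"
    using pseudo_divmod[OF \<open>g \<noteq> 0\<close> sr] lc by auto
  have "r = 0"
  proof (rule ccontr)
    assume "r \<noteq> 0"
    have inj: "inj_on ?r (totatives n)"
    \<comment> \<open>For n = 1 the only totative is 1, which is outside \<open>{..<n}\<close>;
      injectivity is then trivial.\<close>
    proof (cases "n = 1")
      case False
      have "totatives n \<subseteq> {..<n}"
        using False assms(1) totatives_less by fastforce
      moreover have "inj_on ?r {..<n}"
        using bij_betw_roots_unity[OF assms(1)] by (simp add: bij_betw_def)
      ultimately show ?thesis by (rule inj_on_subset[rotated])
    qed simp
    have "?M r = 0"
    proof (rule poly_eqI_degree[where A = "?r ` totatives n"])
      fix z assume "z \<in> ?r ` totatives n"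
      then obtain k where k: "k \<in> totatives n" "z = ?r k" by blast
      have "poly (?M g) z = 0"
        unfolding Mg cyclotomic_complex_def using k by (auto simp: poly_prod)
      moreover have "poly (?M N) z = 0" using root k by simp
      ultimately show "poly (?M r) z = poly 0 z"
        unfolding N by (simp add: map_poly_of_int_mult map_poly_of_int_add)
    qed (use \<open>r \<noteq> 0\<close> r degM deg in \<open>auto simp: card_image[OF inj]\<close>)
    thus False using map_poly_of_int_inj[of r 0] \<open>r \<noteq> 0\<close> by simp
  qed
  thus ?thesis using N by (simp add: g_def)
qed

section \<open>The congruences\<close>

text \<open>At every primitive n-th root of unity the sum has value 0, so its reduced numerator
  vanishes at all roots of \<open>cyclotomic n\<close>.\<close>

lemma qcong_sum_0:
  fixes n s :: nat
  assumes "n > 1" and "[n = 1] (mod 3)"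
  shows "qcong (\<Sum>k=0..(n - 1) div 3. qint \<q> (6 * k + 1)
             * (qpoch \<q> (\<q>^3) k ^ (2 * s) * qpoch (\<q>^3) (\<q>^3) (2 * k))
             / (qpoch (\<q>^3) (\<q>^3) k ^ (2 * s) * qpoch (\<q>^2) (\<q>^3) (2 * k))
             * \<q> powi (2 * (int s - 2) * int k)) 0 (cyclotomic n)"
proof -
  define m where "m = (n - 1) div 3"
  have n: "n = 3 * m + 1" and m: "m > 0"
    using assms unfolding cong_def m_def by presburger+
  show ?thesis
    unfolding qcong_def diff_zero m_def[symmetric]
  proof (intro cyclotomic_dvd numerator_root)
    fix k assume "k \<in> totatives n"
    define z where "z = cis (2 * pi * real k / real n)"
    have prim: "z ^ j = 1 \<longleftrightarrow> 3 * m + 1 dvd j" for j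
      using cis_root_power_eq_1_iff[of n k j] \<open>k \<in> totatives n\<close> unfolding z_def n
      by (simp add: in_totatives_iff)
    have "evaluates_to z (\<Sum>k=0..m. qint \<q> (6 * k + 1)
             * (qpoch \<q> (\<q>^3) k ^ (2 * s) * qpoch (\<q>^3) (\<q>^3) (2 * k))
             / (qpoch (\<q>^3) (\<q>^3) k ^ (2 * s) * qpoch (\<q>^2) (\<q>^3) (2 * k))
             * \<q> powi (2 * (int s - 2) * int k))
        (\<Sum>k=0..m. qint z (6 * k + 1)
             * (qpoch z (z^3) k ^ (2 * s) * qpoch (z^3) (z^3) (2 * k))
             / (qpoch (z^3) (z^3) k ^ (2 * s) * qpoch (z^2) (z^3) (2 * k))
             * z powi (2 * (int s - 2) * int k))"
    proof (intro evaluates_to_sum evaluates_to_mult evaluates_to_divide evaluates_to_power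
        evaluates_to_power_int evaluates_to_qint evaluates_to_qpoch evaluates_to_indet)
      fix k assume "k \<in> {0..m}"
      thus "qpoch (z^3) (z^3) k ^ (2 * s) * qpoch (z^2) (z^3) (2 * k) \<noteq> 0"
        using qpoch_cube_nonzero[OF m prim, of k] qpoch_square_nonzero[OF m prim, of "2 * k"]
        by simp
      show "z \<noteq> 0" by (simp add: z_def)
    qed
    thus "evaluates_to (cis (2 * pi * real k / real n)) (\<Sum>k=0..m. qint \<q> (6 * k + 1)
             * (qpoch \<q> (\<q>^3) k ^ (2 * s) * qpoch (\<q>^3) (\<q>^3) (2 * k))
             / (qpoch (\<q>^3) (\<q>^3) k ^ (2 * s) * qpoch (\<q>^2) (\<q>^3) (2 * k))
             * \<q> powi (2 * (int s - 2) * int k)) 0"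
      by (simp only: sum_root_of_unity_eq_0[OF m prim] flip: z_def)
  qed (use assms in simp)
qed

theorem theorem9p1:
  fixes n :: nat
  assumes "n > 1" and "[n = 1] (mod 3)"
  shows "qcong (\<Sum>k=0..(n - 1) div 3. qint \<q> (6 * k + 1)
             * (qpoch \<q> (\<q>^3) k ^ 6 * qpoch (\<q>^3) (\<q>^3) (2 * k))
             / (qpoch (\<q>^3) (\<q>^3) k ^ 6 * qpoch (\<q>^2) (\<q>^3) (2 * k))
             * \<q> ^ (2 * k)) 0 (cyclotomic n)
       \<and> qcong (\<Sum>k=0..(n - 1) div 3. qint \<q> (6 * k + 1)
             * (qpoch \<q> (\<q>^3) k ^ 4 * qpoch (\<q>^3) (\<q>^3) (2 * k))
             / (qpoch (\<q>^3) (\<q>^3) k ^ 4 * qpoch (\<q>^2) (\<q>^3) (2 * k))) 0 (cyclotomic n)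
       \<and> qcong (\<Sum>k=0..(n - 1) div 3. qint \<q> (6 * k + 1)
             * (qpoch \<q> (\<q>^3) k ^ 2 * qpoch (\<q>^3) (\<q>^3) (2 * k))
             / (qpoch (\<q>^3) (\<q>^3) k ^ 2 * qpoch (\<q>^2) (\<q>^3) (2 * k))
             * \<q> powi (- 2 * int k)) 0 (cyclotomic n)"
proof -
  \<comment> \<open>For s = 3, 2, 1 the weight exponents are 2k, 0 and -2k. Only the first sum is
    stated with a natural power, which is matched here.\<close>
  have "\<q> ^ (2 * k) = \<q> powi (2 * (int 3 - 2) * int k)" for k
    using power_int_of_nat[of \<q> "2 * k"] by simp
  thus ?thesis
    using qcong_sum_0[OF assms, of 3] qcong_sum_0[OF assms, of 2] qcong_sum_0[OF assms, of 1]
    by simp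
qed

end
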